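(* Let $n\ge 2$ and let $X=(x_{ij})$ be an arbitrary (not necessarily symmetric) $n\times n$ matrix. Then for all $1\le j<i\le n$, $$x_{ij}\;=\;\sum_{S} W_{\mathscr S}(S),$$ where the sum runs over all Schröder paths $S$ in $G'_n$ from node $j$ to node $i-1$. This is an identity of rational functions in the entries of a generic $n\times n$ matrix.
   Context: Minors: for an $n\times n$ matrix $X$ and $I,J\subseteq[n]$ with $|I|=|J|$, $X^J_I$ is the determinant of the submatrix with rows $I$ and columns $J$ (both in increasing order; empty minor $=1$). Set $p_I=(-1)^{\lfloor |I|/2\rfloor}X^I_I$ (so $p_\emptyset=1$) and, for distinct $i,j\notin I$, $a_{ij|I}=(-1)^{\lceil |I|/2\rceil}X^{\{j\}\cup I}_{\{i\}\cup I}$. The graph $G'_n$: vertices are the lattice points $(x,y)$ with $0\le y\le x$, $x+y\le 2n-4$, $x+y$ even; edges are steps $(1,1)$, $(1,-1)$ and horizontal steps $(2,0)$. For $1\le k\le n-1$, "node $k$" is $(2k-2,0)$. Each vertex $v=(x,y)$ gets labels: put $i=(x+y+4)/2$, $j=(x-y+2)/2$ (so $1\le j<i\le n$), $I(v)=\{j+1,\dots,i-1\}$, $A(v)=a_{ij|I(v)}$ and $P(v)=p_{I(v)}$ (the label of the triangle directly below $v$; $P(v)=p_\emptyset=1$ when $y=0$). A Schröder path from node $j$ to node $i-1$ is a sequence of lattice points $v_0,\dots,v_m$ with $v_0=(2j-2,0)$, $v_m=(2i-4,0)$, each step in $\{(1,1),(1,-1),(2,0)\}$ and all $y$-coordinates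 $\ge0$. A vertex $v_k$ (endpoints allowed) is a weak local maximum if none of its neighbours in the sequence ($v_{k-1}$ if $k>0$, $v_{k+1}$ if $k<m$) has larger $y$-coordinate, and a weak local minimum if none has smaller $y$-coordinate. For $0<k<m$, $v_k$ is a strict local maximum (resp. strict local minimum) if both neighbours have smaller (resp. larger) $y$-coordinate. The weight is $$W_{\mathscr S}(S)=\frac{\prod_{v\ \text{weak loc. max}}A(v)\ \prod_{v\ \text{weak loc. min}}P(v)}{\prod_{h}P\big((x_h,y_h+1)\big)\ \prod_{h:\,y_h\ge1}A\big((x_h,y_h-1)\big)\ \prod_{v\ \text{strict loc. max}}P(v)\ \prod_{v\ \text{strict loc. min}}A(v)},$$ where $h$ ranges over the horizontal steps of $S$, $(x_h,y_h)$ denoting the midpoint of the horizontal step $h$ (so $P((x_h,y_h+1))$ is the label of the triangle whose base is $h$, and $A((x_h,y_h-1))$ is the label of the vertex immediately below $h$). *)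

theory Defs
  imports
    "Jordan_Normal_Form.Determinant"
    "Jordan_Normal_Form.DL_Submatrix"
    "HOL-Library.Poly_Mapping"
    "HOL-Library.Product_Lexorder"
    "HOL-Library.Product_Plus"
    "HOL-Computational_Algebra.Fraction_Field"
begin

section \<open>Minors\<close>

text \<open>
  Row and column labels are 1-based as in the mathematics, whereas matrices of type \<^typ>\<open>'a mat\<close>
  are indexed from 0; hence the shift by \<^const>\<open>Suc\<close>.  All index sets used below are finite sets of
  positive numbers.
\<close>

definition minor :: "'a::comm_ring_1 mat \<Rightarrow> nat set \<Rightarrow> nat set \<Rightarrow> 'a" where
  "minor X I J = det (submatrix X {k. Suc k \<in> I} {k. Suc k \<in> J})"

definition p_minor :: "'a::comm_ring_1 mat \<Rightarrow> nat set \<Rightarrow> 'a" where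
  "p_minor X I = (- 1) ^ (card I div 2) * minor X I I"

text \<open>The exponent \<open>(card I + 1) div 2\<close> is the ceiling of \<open>card I / 2\<close>.\<close>

definition a_minor :: "'a::comm_ring_1 mat \<Rightarrow> nat \<Rightarrow> nat \<Rightarrow> nat set \<Rightarrow> 'a" where
  "a_minor X i j I = (- 1) ^ ((card I + 1) div 2) * minor X (insert i I) (insert j I)"


section \<open>The graph and its labels\<close>

type_synonym point = "int \<times> int"

definition vertices :: "nat \<Rightarrow> point set" where
  "vertices n = {(x, y). 0 \<le> y \<and> y \<le> x \<and> x + y \<le> 2 * int n - 4 \<and> even (x + y)}"

definition edges :: "nat \<Rightarrow> (point \<times> point) set" where
  "edges n = {(u, v). u \<in> vertices n \<and> v \<in> vertices n \<and> v - u \<in> {(1, 1), (1, -1), (2, 0)}}"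

definition node :: "nat \<Rightarrow> point" where
  "node k = (2 * int k - 2, 0)"

text \<open>The divisions by 2 are exact, because \<open>x + y\<close> is even for every vertex \<open>(x, y)\<close>.\<close>

definition i_of :: "point \<Rightarrow> nat" where
  "i_of v = nat ((fst v + snd v + 4) div 2)"

definition j_of :: "point \<Rightarrow> nat" where
  "j_of v = nat ((fst v - snd v + 2) div 2)"

definition I_of :: "point \<Rightarrow> nat set" where
  "I_of v = {j_of v <..< i_of v}"

definition A_label :: "'a::comm_ring_1 mat \<Rightarrow> point \<Rightarrow> 'a" where
  "A_label X v = a_minor X (i_of v) (j_of v) (I_of v)"

definition P_label :: "'a::comm_ring_1 mat \<Rightarrow> point \<Rightarrow> 'a" where
  "P_label X v = p_minor X (I_of v)"


section \<open>Schroeder paths\<close>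

definition schroeder_paths :: "nat \<Rightarrow> point \<Rightarrow> point \<Rightarrow> point list set" where
  "schroeder_paths n u v =
     {S. S \<noteq> [] \<and> hd S = u \<and> last S = v \<and> set S \<subseteq> vertices n \<and>
         successively (\<lambda>a b. (a, b) \<in> edges n) S}"

definition weak_local_max :: "point list \<Rightarrow> nat set" where
  "weak_local_max S = {k. k < length S \<and>
     (0 < k \<longrightarrow> snd (S ! (k - 1)) \<le> snd (S ! k)) \<and>
     (k + 1 < length S \<longrightarrow> snd (S ! (k + 1)) \<le> snd (S ! k))}"

definition weak_local_min :: "point list \<Rightarrow> nat set" where
  "weak_local_min S = {k. k < length S \<and>
     (0 < k \<longrightarrow> snd (S ! k) \<le> snd (S ! (k - 1))) \<and>
     (k + 1 < length S \<longrightarrow> snd (S ! k) \<le> snd (S ! (k + 1)))}"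

definition strict_local_max :: "point list \<Rightarrow> nat set" where
  "strict_local_max S = {k. 0 < k \<and> k + 1 < length S \<and>
     snd (S ! (k - 1)) < snd (S ! k) \<and> snd (S ! (k + 1)) < snd (S ! k)}"

definition strict_local_min :: "point list \<Rightarrow> nat set" where
  "strict_local_min S = {k. 0 < k \<and> k + 1 < length S \<and>
     snd (S ! k) < snd (S ! (k - 1)) \<and> snd (S ! k) < snd (S ! (k + 1))}"

definition horizontal_midpoints :: "point list \<Rightarrow> point set" where
  "horizontal_midpoints S =
     {S ! k + (1, 0) | k. k + 1 < length S \<and> S ! (k + 1) - S ! k = (2, 0)}"

definition weight_num :: "'a::field mat \<Rightarrow> point list \<Rightarrow> 'a" where
  "weight_num X S =
     (\<Prod>k\<in>weak_local_max S. A_label X (S ! k)) * (\<Prod>k\<in>weak_local_min S. P_label X (S ! k))"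

definition weight_denom :: "'a::field mat \<Rightarrow> point list \<Rightarrow> 'a" where
  "weight_denom X S =
     (\<Prod>h\<in>horizontal_midpoints S. P_label X (h + (0, 1))) *
     (\<Prod>h\<in>{h \<in> horizontal_midpoints S. 1 \<le> snd h}. A_label X (h - (0, 1))) *
     (\<Prod>k\<in>strict_local_max S. P_label X (S ! k)) *
     (\<Prod>k\<in>strict_local_min S. A_label X (S ! k))"

definition weight :: "'a::field mat \<Rightarrow> point list \<Rightarrow> 'a" where
  "weight X S = weight_num X S / weight_denom X S"


section \<open>The generic matrix\<close>

text \<open>
  Polynomials over \<open>'a\<close> in the commuting indeterminates \<open>x(i, j)\<close>, for pairs of natural numbers
  \<open>(i, j)\<close>, are finitely supported coefficient functions on monomials, and monomials are finitely
  supported exponent functions on the index pairs.  The lexicographic order on pairs is there only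
  for the instance that makes these polynomials an integral domain.
\<close>

type_synonym 'a xpoly = "((nat \<times> nat) \<Rightarrow>\<^sub>0 nat) \<Rightarrow>\<^sub>0 'a"

type_synonym 'a xratfun = "'a xpoly fract"

definition indet :: "nat \<Rightarrow> nat \<Rightarrow> 'a::field xratfun" where
  "indet i j = Fract (Poly_Mapping.single (Poly_Mapping.single (i, j) 1) 1) 1"

definition generic_mat :: "nat \<Rightarrow> 'a::field xratfun mat" where
  "generic_mat n = mat n n (\<lambda>(i, j). indet (Suc i) (Suc j))"


section \<open>Sanity checks\<close>

lemma finite_vertices: "finite (vertices n)"
proof (rule finite_subset)
  show "vertices n \<subseteq> {0..2 * int n} \<times> {0..2 * int n}"
    by (auto simp: vertices_def)
qed auto

lemma path_sorted:
  assumes "successively (\<lambda>a b. (a, b) \<in> edges n) S"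
  shows "sorted_wrt (\<lambda>a b. fst a < fst b) S"
proof -
  have "successively (\<lambda>a b. fst a < fst b) S"
    by (rule successively_mono[OF assms]) (auto simp: edges_def prod_eq_iff)
  moreover have "transp (\<lambda>a b :: point. fst a < fst b)"
    by (auto simp: transp_def)
  ultimately show ?thesis
    using successively_conv_sorted_wrt by blast
qed

lemma finite_schroeder_paths: "finite (schroeder_paths n u v)"
proof (rule finite_subset)
  show "schroeder_paths n u v \<subseteq> {S. set S \<subseteq> vertices n \<and> distinct S}"
  proof
    fix S assume S: "S \<in> schroeder_paths n u v"
    then have "sorted_wrt (\<lambda>a b. fst a < fst b) S"
      by (auto simp: schroeder_paths_def intro: path_sorted)
    then have "distinct S"
      by (auto simp: sorted_wrt_iff_nth_less distinct_conv_nth)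
        (metis less_irrefl linorder_neqE_nat)
    with S show "S \<in> {S. set S \<subseteq> vertices n \<and> distinct S}"
      by (auto simp: schroeder_paths_def)
  qed
  show "finite {S. set S \<subseteq> vertices n \<and> distinct S}"
    by (rule finite_subset_distinct[OF finite_vertices])
qed

text \<open>
  Between nodes of the graph, membership in the graph only amounts to the path staying weakly above
  the horizontal axis.
\<close>

lemma schroeder_paths_node_iff:
  assumes "1 \<le> j" "j < i" "i \<le> n"
  shows "S \<in> schroeder_paths n (node j) (node (i - 1)) \<longleftrightarrow>
    S \<noteq> [] \<and> hd S = node j \<and> last S = node (i - 1) \<and> (\<forall>v\<in>set S. 0 \<le> snd v) \<and>
    successively (\<lambda>a b. b - a \<in> {(1, 1), (1, -1), (2, 0)}) S"
    (is "_ \<longleftrightarrow> ?R")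
proof
  assume "S \<in> schroeder_paths n (node j) (node (i - 1))"
  then show ?R
    by (auto simp: schroeder_paths_def vertices_def edges_def elim!: successively_mono)
next
  assume R: ?R
  let ?st = "\<lambda>a b :: point. b - a \<in> {(1, 1), (1, -1), (2, 0)}"
  have step: "?st (S ! k) (S ! Suc k)" if "Suc k < length S" for k
    using R that by (auto simp: successively_conv_nth)
  have low: "snd (S ! k) \<le> fst (S ! k) \<and> even (fst (S ! k) + snd (S ! k))"
    if "k < length S" for k
    using that
  proof (induction k)
    case 0
    then have "S ! 0 = node j" using R by (metis hd_conv_nth)
    then show ?case using assms by (auto simp: node_def)
  next
    case (Suc k)
    then show ?case using step[of k]
      by (cases "S ! k"; cases "S ! Suc k") (auto simp: algebra_simps)
  qed
  have up: "fst (S ! (length S - Suc k)) + snd (S ! (length S - Suc k)) \<le> 2 * int n - 4"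
    if "k < length S" for k
    using that
  proof (induction k)
    case 0
    then have "S ! (length S - Suc 0) = node (i - 1)" using R by (metis last_conv_nth One_nat_def)
    then show ?case using assms by (auto simp: node_def of_nat_diff)
  next
    case (Suc k)
    have "Suc (length S - Suc (Suc k)) = length S - Suc k" using Suc.prems by simp
    moreover from this have "length S - Suc k < length S" using Suc.prems by linarith
    ultimately show ?case using Suc step[of "length S - Suc (Suc k)"]
      by (cases "S ! (length S - Suc (Suc k))"; cases "S ! (length S - Suc k)")
        (auto simp: algebra_simps)
  qed
  have V: "set S \<subseteq> vertices n"
  proof
    fix v assume "v \<in> set S"
    then obtain k where k: "k < length S" "v = S ! k" by (metis in_set_conv_nth)
    have "0 \<le> snd v" using R \<open>v \<in> set S\<close> by auto
    moreover have "fst v + snd v \<le> 2 * int n - 4"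
      using up[of "length S - Suc k"] k by simp
    ultimately show "v \<in> vertices n"
      using low[OF k(1)] k(2) by (auto simp: vertices_def split: prod.splits)
  qed
  have "successively (\<lambda>a b. (a, b) \<in> edges n) S"
    unfolding successively_conv_nth
  proof (intro allI impI)
    fix k assume "Suc k < length S"
    then show "(S ! k, S ! Suc k) \<in> edges n"
      using step[of k] V nth_mem[of k S] nth_mem[of "Suc k" S] by (auto simp: edges_def)
  qed
  with R V show "S \<in> schroeder_paths n (node j) (node (i - 1))"
    by (auto simp: schroeder_paths_def)
qed

end

theory Submission
  imports Defs
begin

text \<open>
  Index the vertex with labels \<open>i\<close> and \<open>j\<close> by \<open>(i, j)\<close>, so that the three kinds of steps increase
  \<open>i\<close>, \<open>j\<close> or both by 1.  The weight makes sense for a path ending at any vertex, and appending a step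
  to a path multiplies it by a factor that only depends on the step:
  \<open>A(v) / A(u)\<close> for a step up from \<open>u\<close> to \<open>v\<close>, \<open>P(v) / P(u)\<close> for a step down, and
  \<open>A(v) P(v)\<close> divided by the two adjacent labels for a horizontal step.  Hence the sum \<open>G(i, j)\<close> of the
  weights of all paths from node \<open>a\<close> to \<open>(i, j)\<close> satisfies a linear three-term recurrence.  The same
  recurrence is satisfied, up to signs, by the minor \<open>b(i, j)\<close> with rows \<open>j + 1, \<dots>, i\<close> and columns
  \<open>j + 1, \<dots>, i - 1, a\<close>: all the minors involved are linear in the entries of column \<open>a\<close>, and on the
  rows \<open>j, \<dots>, i\<close> this column is a linear combination of the columns \<open>j, \<dots>, i - 1\<close> and the last unit
  vector, as \<open>P(i, j - 1)\<close> does not vanish.  Finally \<open>b(i, i - 1)\<close> is a single matrix entry.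
\<close>

section \<open>Bordered determinants\<close>

text \<open>Indices count from 0, so \<open>r\<close> and \<open>m\<close> select the labels
  \<open>r + 1, ..., r + m\<close> of the 1-based mathematics.\<close>

definition principal_det :: "(nat \<Rightarrow> nat \<Rightarrow> 'a::comm_ring_1) \<Rightarrow> nat \<Rightarrow> nat \<Rightarrow> 'a" where
  "principal_det x r m = det (mat m m (\<lambda>(k, l). x (r + k) (r + l)))"

text \<open>The border \<open>u\<close> is a free column, so that one notion covers both the labels
  (\<open>u\<close> is column \<open>j\<close>) and the path sums (\<open>u\<close> is column
  \<open>a\<close>).\<close>

definition bordered_det ::
    "(nat \<Rightarrow> nat \<Rightarrow> 'a::comm_ring_1) \<Rightarrow> nat \<Rightarrow> nat \<Rightarrow> (nat \<Rightarrow> 'a) \<Rightarrow> 'a" where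
  "bordered_det x r s u =
     det (mat (s - r) (s - r) (\<lambda>(k, l). if Suc l = s - r then u (r + k) else x (r + k) (r + l)))"

text \<open>Laplace expansion along the last column: its cofactors do not involve that column, so a
  single \<open>w\<close> serves all \<open>u\<close>. The bottom cofactor has sign 1 and deletes
  the last row and column.\<close>

lemma bordered_det_expand:
  assumes "r < s"
  shows "\<exists>w. (\<forall>u. bordered_det x r s u = (\<Sum>k<s - r. u (r + k) * w k)) \<and>
           w (s - r - 1) = principal_det x r (s - r - 1)"
proof -
  define m where "m = s - r - 1"
  have m: "s - r = Suc m" using assms by (simp add: m_def)
  define M where "M u = mat (Suc m) (Suc m) (\<lambda>(k, l). if l = m then u (r + k) else x (r + k) (r + l))"
    for u
  define w where "w k = (- 1) ^ (k + m) * det (mat m m (\<lambda>(k', l'). x (r + (if k' < k then k' else Suc k')) (r + l')))"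
    for k
  have del: "mat_delete (M u) k m = mat m m (\<lambda>(k', l'). x (r + (if k' < k then k' else Suc k')) (r + l'))"
    if "k < Suc m" for u k
    using that by (intro eq_matI) (auto simp: mat_delete_def M_def)
  have "bordered_det x r s u = (\<Sum>k<s - r. u (r + k) * w k)" for u
  proof -
    have "bordered_det x r s u = det (M u)"
      by (auto simp: bordered_det_def M_def m intro!: arg_cong[where f = det] cong_mat)
    also have "\<dots> = (\<Sum>k<Suc m. M u $$ (k, m) * cofactor (M u) k m)"
      by (rule laplace_expansion_column) (auto simp: M_def)
    also have "\<dots> = (\<Sum>k<Suc m. u (r + k) * w k)"
      by (intro sum.cong) (auto simp: cofactor_def del w_def, auto simp: M_def)
    finally show ?thesis by (simp only: m)
  qed
  moreover have "w m = principal_det x r m"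
    by (auto simp: w_def principal_det_def intro!: arg_cong[where f = det] eq_matI)
  ultimately show ?thesis unfolding m_def by blast
qed

text \<open>All borders share the cofactors of \<open>bordered_det_expand\<close>, and only the rows
  \<open>r, ..., s - 1\<close> enter. The separate summand \<open>h * v k\<close> is meant for the
  unit vector.\<close>

lemma bordered_det_linear:
  assumes "r < s"
    and "\<And>k. r \<le> k \<Longrightarrow> k < s \<Longrightarrow> u k = (\<Sum>c\<in>C. g c * f c k) + h * v k"
  shows "bordered_det x r s u = (\<Sum>c\<in>C. g c * bordered_det x r s (f c)) + h * bordered_det x r s v"
proof -
  obtain w where w: "bordered_det x r s u = (\<Sum>k<s - r. u (r + k) * w k)" for u
    using bordered_det_expand[OF assms(1)] by blast
  have "(\<Sum>k<s - r. u (r + k) * w k) =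
      (\<Sum>k<s - r. ((\<Sum>c\<in>C. g c * f c (r + k)) + h * v (r + k)) * w k)"
    by (intro sum.cong) (use assms in auto)
  also have "\<dots> = (\<Sum>k<s - r. \<Sum>c\<in>C. g c * (f c (r + k) * w k)) + h * (\<Sum>k<s - r. v (r + k) * w k)"
    by (simp add: distrib_right sum.distrib sum_distrib_right sum_distrib_left mult.assoc)
  also have "(\<Sum>k<s - r. \<Sum>c\<in>C. g c * (f c (r + k) * w k)) =
      (\<Sum>c\<in>C. g c * (\<Sum>k<s - r. f c (r + k) * w k))"
    by (subst sum.swap) (simp add: sum_distrib_left)
  finally show ?thesis by (simp add: w)
qed

text \<open>Column \<open>c\<close> already occurs among the unbordered columns
  \<open>r, ..., s - 2\<close>.\<close>

lemma bordered_det_repeated: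
  assumes "r \<le> c" "Suc c < s"
  shows "bordered_det x r s (\<lambda>k. x k c) = 0"
  unfolding bordered_det_def
  by (rule det_identical_columns[where i = "c - r" and j = "s - r - 1"])
    (use assms in \<open>auto intro!: eq_vecI simp: col_def\<close>)

lemma bordered_det_next: "bordered_det x r s (\<lambda>k. x k (s - 1)) = principal_det x r (s - r)"
proof -
  have "s - 1 = r + l" if "Suc l = s - r" for l
    using that by linarith
  then show ?thesis
    unfolding bordered_det_def principal_det_def
    by (intro arg_cong[where f = det] cong_mat) auto
qed

lemma bordered_det_zero: "r < s \<Longrightarrow> (\<And>k. r \<le> k \<Longrightarrow> k < s \<Longrightarrow> u k = 0) \<Longrightarrow> bordered_det x r s u = 0"
  using bordered_det_linear[where u = u and C = "{}" and h = 0 and x = x] by simp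

text \<open>The unit vector picks out the bottom cofactor of the Laplace expansion.\<close>

lemma bordered_det_unit:
  assumes "r \<le> s"
  shows "bordered_det x r (Suc s) (\<lambda>k. if k = s then 1 else 0) = principal_det x r (s - r)"
proof -
  obtain w where w: "bordered_det x r (Suc s) u = (\<Sum>k<Suc s - r. u (r + k) * w k)"
      and p: "w (s - r) = principal_det x r (s - r)" for u
    using bordered_det_expand[of r "Suc s" x] assms by (auto simp: Suc_diff_le)
  have "bordered_det x r (Suc s) (\<lambda>k. if k = s then 1 else 0) =
      (\<Sum>k<Suc s - r. if k = s - r then w k else 0)"
    unfolding w by (intro sum.cong) (use assms in auto)
  also have "\<dots> = w (s - r)" using assms by simp
  finally show ?thesis by (simp add: p)
qed

text \<open>
  The columns \<open>q, \<dots>, s - 1\<close> of \<open>x\<close> together with the last unit vector span all column vectors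
  on the rows \<open>q, \<dots>, s\<close>, and a bordered determinant is linear in its last column.
\<close>

lemma bordered_det_coordinates:
  fixes x :: "nat \<Rightarrow> nat \<Rightarrow> 'a::field"
  assumes "q < s" and p: "principal_det x q (s - q) \<noteq> 0"
  obtains g h where
    "bordered_det x (Suc q) (Suc s) u =
       g q * bordered_det x (Suc q) (Suc s) (\<lambda>k. x k q) + h * principal_det x (Suc q) (s - Suc q)"
    "Suc q < s \<Longrightarrow> bordered_det x (Suc q) s u =
       g q * bordered_det x (Suc q) s (\<lambda>k. x k q) + g (s - 1) * principal_det x (Suc q) (s - Suc q)"
    "bordered_det x q s u = g (s - 1) * principal_det x q (s - q)"
    "bordered_det x q (Suc s) u = h * principal_det x q (s - q)"
proof -
  define B where "B = mat (s - q) (s - q) (\<lambda>(k, l). x (q + k) (q + l))"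
  have B: "B \<in> carrier_mat (s - q) (s - q)" by (simp add: B_def)
  have dB: "det B \<noteq> 0" using p by (simp add: B_def principal_det_def)
  define b where "b = vec (s - q) (\<lambda>k. u (q + k))"
  \<comment> \<open>Cramer's rule: the adjugate solves the system up to the factor
    \<open>det B\<close>, which the definition of \<open>g\<close> divides out.\<close>
  define y where "y = adj_mat B *\<^sub>v b"
  have ydim: "y \<in> carrier_vec (s - q)"
    unfolding y_def by (rule mult_mat_vec_carrier[OF adj_mat(1)[OF B]]) (simp add: b_def)
  have By: "B *\<^sub>v y = det B \<cdot>\<^sub>v b"
    unfolding y_def using adj_mat(1,2)[OF B] B
    by (subst assoc_mult_mat_vec[symmetric]) (auto simp: b_def)
  define g where "g c = y $ (c - q) / det B" for c
  \<comment> \<open>\<open>B\<close> only controls the rows \<open>q, ..., s - 1\<close>;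
    \<open>h\<close> absorbs the discrepancy left in row \<open>s\<close>.\<close>
  define h where "h = u s - (\<Sum>c = q..<s. g c * x s c)"
  define e :: "nat \<Rightarrow> 'a" where "e k = (if k = s then 1 else 0)" for k
  have rep: "u k = (\<Sum>c = q..<s. g c * x k c) + h * e k" if "q \<le> k" "k \<le> s" for k
  proof (cases "k = s")
    case True
    then show ?thesis by (simp add: h_def e_def)
  next
    case False
    then have k: "k - q < s - q" using that by simp
    have "det B * u k = (B *\<^sub>v y) $ (k - q)" using k that by (simp add: By b_def)
    also have "\<dots> = (\<Sum>l = 0..<s - q. x k (q + l) * y $ l)"
      using k B ydim that by (simp add: scalar_prod_def B_def)
    also have "\<dots> = (\<Sum>c = q..<s. x k c * y $ (c - q))"
      by (rule sum.reindex_bij_witness[of _ "\<lambda>c. c - q" "\<lambda>l. q + l"]) auto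
    also have "\<dots> = det B * (\<Sum>c = q..<s. g c * x k c)"
      using dB by (simp add: g_def sum_distrib_left mult.commute)
    finally show ?thesis using dB False by (simp add: e_def)
  qed
  have lin: "bordered_det x a b u =
      (\<Sum>c = q..<s. g c * bordered_det x a b (\<lambda>k. x k c)) + h * bordered_det x a b e"
    if "q \<le> a" "a < b" "b \<le> Suc s" for a b
    by (rule bordered_det_linear) (use that rep in auto)
  have z: "bordered_det x a b e = 0" if "a < b" "b \<le> s" for a b
    by (rule bordered_det_zero) (use that in \<open>auto simp: e_def\<close>)
  have e: "bordered_det x a (Suc s) e = principal_det x a (s - a)" if "a \<le> s" for a
    using bordered_det_unit[OF that] by (simp add: e_def[abs_def])
  have top: "bordered_det x a s (\<lambda>k. x k (s - 1)) = principal_det x a (s - a)" for a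
    by (rule bordered_det_next)
  show ?thesis
  proof (rule that)
    show "bordered_det x (Suc q) (Suc s) u =
       g q * bordered_det x (Suc q) (Suc s) (\<lambda>k. x k q) + h * principal_det x (Suc q) (s - Suc q)"
      using assms(1) by (simp add: lin e sum.atLeast_Suc_lessThan bordered_det_repeated)
    show "bordered_det x (Suc q) s u =
       g q * bordered_det x (Suc q) s (\<lambda>k. x k q) + g (s - 1) * principal_det x (Suc q) (s - Suc q)"
      if "Suc q < s"
    proof -
      obtain t where t: "s = Suc t" "q < t" using \<open>Suc q < s\<close> by (cases s) auto
      have "bordered_det x (Suc q) s u = (\<Sum>c = q..<s. g c * bordered_det x (Suc q) s (\<lambda>k. x k c))"
        using that by (simp add: lin z)
      \<comment> \<open>Two columns survive: \<open>q\<close> lies outside the block, and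
        \<open>t = s - 1\<close> completes it to a principal one. The columns in between are
        repeated.\<close>
      also have "{q..<s} = insert q (insert t {Suc q..<t})" using t by auto
      also have "(\<Sum>c\<in>\<dots>. g c * bordered_det x (Suc q) s (\<lambda>k. x k c)) =
          g q * bordered_det x (Suc q) s (\<lambda>k. x k q) + g t * bordered_det x (Suc q) s (\<lambda>k. x k t)"
        using t by (simp add: bordered_det_repeated)
      finally show ?thesis using t top[of "Suc q"] by simp
    qed
    show "bordered_det x q s u = g (s - 1) * principal_det x q (s - q)"
    proof -
      obtain t where t: "s = Suc t" "q \<le> t" using assms(1) by (cases s) auto
      have "bordered_det x q s u = (\<Sum>c = q..<s. g c * bordered_det x q s (\<lambda>k. x k c))"
        using assms(1) by (simp add: lin z)
      also have "\<dots> = g t * bordered_det x q s (\<lambda>k. x k t)"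
        using t by (simp add: bordered_det_repeated)
      finally show ?thesis using t top[of q] by simp
    qed
    show "bordered_det x q (Suc s) u = h * principal_det x q (s - q)"
      using assms(1) by (simp add: lin e bordered_det_repeated)
  qed
qed

text \<open>Eliminates \<open>g q\<close>, \<open>g (s - 1)\<close> and \<open>h\<close> from the
  four identities of \<open>bordered_det_coordinates\<close>.\<close>

lemma bordered_det_recurrence:
  fixes x :: "nat \<Rightarrow> nat \<Rightarrow> 'a::field"
  assumes "Suc q < s" and "principal_det x q (s - q) \<noteq> 0"
  shows "bordered_det x (Suc q) (Suc s) u * bordered_det x (Suc q) s (\<lambda>k. x k q) *
      principal_det x q (s - q) =
    bordered_det x (Suc q) s u * bordered_det x (Suc q) (Suc s) (\<lambda>k. x k q) *
      principal_det x q (s - q) -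
    bordered_det x q s u * bordered_det x (Suc q) (Suc s) (\<lambda>k. x k q) *
      principal_det x (Suc q) (s - Suc q) +
    bordered_det x q (Suc s) u * bordered_det x (Suc q) s (\<lambda>k. x k q) *
      principal_det x (Suc q) (s - Suc q)"
proof -
  have "q < s" using assms by simp
  then show ?thesis
    by (rule bordered_det_coordinates[OF _ assms(2), of u])
      (simp only: assms(1) True_implies_equals algebra_simps)
qed

text \<open>The boundary case \<open>s = Suc q\<close>, for vertices on the axis: columns
  \<open>q\<close> and \<open>s - 1\<close> coincide, and so do the coordinates \<open>g q\<close>
  and \<open>g (s - 1)\<close>.\<close>

lemma bordered_det_recurrence_bottom:
  fixes x :: "nat \<Rightarrow> nat \<Rightarrow> 'a::field"
  assumes "x q q \<noteq> 0"
  shows "bordered_det x (Suc q) (Suc (Suc q)) u * x q q =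
    bordered_det x q (Suc q) u * bordered_det x (Suc q) (Suc (Suc q)) (\<lambda>k. x k q) +
    bordered_det x q (Suc (Suc q)) u"
proof -
  have p: "principal_det x q (Suc q - q) = x q q" "principal_det x (Suc q) (Suc q - Suc q) = 1"
    by (simp_all add: principal_det_def det_single)
  show ?thesis
    by (rule bordered_det_coordinates[of q "Suc q" x u]) (use assms p in \<open>simp_all add: algebra_simps\<close>)
qed

section \<open>The labels as determinants\<close>

lemma pick_atLeastLessThan: "a + k < b \<Longrightarrow> pick {a..<b} k = a + k"
proof -
  assume "a + k < b"
  then have "{c \<in> {a..<b}. c < a + k} = {a..<a + k}" by auto
  then show ?thesis using pick_card_in_set[of "a + k" "{a..<b}"] \<open>a + k < b\<close> by simp
qed

lemma submatrix_atLeastLessThan: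
  assumes "b \<le> dim_row X" "d \<le> dim_col X"
  shows "submatrix X {a..<b} {c..<d} = mat (b - a) (d - c) (\<lambda>(k, l). X $$ (a + k, c + l))"
proof -
  have "{k. k < dim_row X \<and> k \<in> {a..<b}} = {a..<b}" "{l. l < dim_col X \<and> l \<in> {c..<d}} = {c..<d}"
    using assms by auto
  then show ?thesis
    unfolding submatrix_def by (intro eq_matI) (auto simp: pick_atLeastLessThan)
qed

text \<open>Inverts \<open>i_of\<close> and \<open>j_of\<close>: solves
  \<open>x + y = 2 * i - 4\<close> and \<open>x - y = 2 * j - 2\<close>.\<close>

definition lattice_point :: "nat \<Rightarrow> nat \<Rightarrow> point" where
  "lattice_point i j = (int i + int j - 3, int i - int j - 1)"

lemma fst_lattice_point [simp]: "fst (lattice_point i j) = int i + int j - 3"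
  and snd_lattice_point [simp]: "snd (lattice_point i j) = int i - int j - 1"
  by (simp_all add: lattice_point_def)

lemma lattice_point_eq_iff [simp]: "lattice_point i j = lattice_point i' j' \<longleftrightarrow> i = i' \<and> j = j'"
  by (auto simp: lattice_point_def)

lemma i_of_lattice_point [simp]: "i_of (lattice_point i j) = i"
  and j_of_lattice_point [simp]: "j_of (lattice_point i j) = j"
  by (simp_all add: i_of_def j_of_def)

lemma node_eq_lattice_point: "node j = lattice_point (Suc j) j"
  by (simp add: node_def lattice_point_def)

lemma lattice_point_in_vertices_iff:
  "lattice_point i j \<in> vertices n \<longleftrightarrow> 1 \<le> j \<and> j < i \<and> i \<le> n"
  by (auto simp: vertices_def lattice_point_def)

lemma vertices_cases:
  assumes "v \<in> vertices n"
  obtains i j where "v = lattice_point i j" "1 \<le> j" "j < i" "i \<le> n"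
proof -
  obtain x y where v: "v = (x, y)" by (cases v)
  have *: "0 \<le> y" "y \<le> x" "x + y \<le> 2 * int n - 4" "even (x + y)"
    using assms by (auto simp: v vertices_def)
  obtain t where t: "x + y = 2 * t" using *(4) by (rule evenE)
  have "v = lattice_point (nat (t + 2)) (nat (t - y + 1))"
    using * t by (auto simp: v lattice_point_def)
  then show ?thesis
    by (rule that) (use * t in auto)
qed

lemma P_label_lattice_point:
  assumes "X \<in> carrier_mat n n" "j < i" "i \<le> Suc n"
  shows "P_label X (lattice_point i j) =
    (- 1) ^ ((i - j - 1) div 2) * principal_det (\<lambda>k l. X $$ (k, l)) j (i - j - 1)"
proof -
  have "{k. Suc k \<in> {j<..<i}} = {j..<i - 1}" by auto
  then show ?thesis
    using assms
    by (auto simp: P_label_def I_of_def p_minor_def minor_def submatrix_atLeastLessThan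
        principal_det_def)
qed

text \<open>Both index sets are intervals, so the minor is a contiguous block whose columns start
  one place before its rows.\<close>

lemma A_label_lattice_point_minor:
  assumes "X \<in> carrier_mat n n" "1 \<le> j" "j < i" "i \<le> n"
  shows "A_label X (lattice_point i j) = (- 1) ^ ((i - j) div 2) *
    det (mat (i - j) (i - j) (\<lambda>(k, l). X $$ (j + k, j - 1 + l)))"
proof -
  have "{k. Suc k \<in> insert i {j<..<i}} = {j..<i}" "{k. Suc k \<in> insert j {j<..<i}} = {j - 1..<i - 1}"
    using assms by auto
  moreover have "i - 1 - (j - 1) = i - j" using assms by simp
  moreover have "(card {j<..<i} + 1) div 2 = (i - j) div 2" using assms by simp
  moreover have "i \<le> dim_row X" "i - 1 \<le> dim_col X" using assms by auto
  ultimately show ?thesis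
    by (simp only: A_label_def I_of_def a_minor_def minor_def i_of_lattice_point
        j_of_lattice_point submatrix_atLeastLessThan)
qed

text \<open>Moving column \<open>j\<close> from the first to the last place costs the sign
  \<open>(- 1) ^ (i - j - 1)\<close>, which turns the ceiling in the exponent into a floor. Thus
  \<open>A\<close> and \<open>P\<close> at a vertex carry the same sign.\<close>

lemma A_label_lattice_point:
  assumes "X \<in> carrier_mat n n" "1 \<le> j" "j < i" "i \<le> n"
  shows "A_label X (lattice_point i j) = (- 1) ^ ((i - j - 1) div 2) *
    bordered_det (\<lambda>k l. X $$ (k, l)) j i (\<lambda>k. X $$ (k, j - 1))"
proof -
  define m where "m = i - j - 1"
  have m: "i - j = Suc m" using assms by (simp add: m_def)
  define M where "M = mat (Suc m) (Suc m)
    (\<lambda>(k, l). if l = m then X $$ (j + k, j - 1) else X $$ (j + k, j + l))"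
  have "bordered_det (\<lambda>k l. X $$ (k, l)) j i (\<lambda>k. X $$ (k, j - 1)) = det M"
    by (auto simp: bordered_det_def M_def m intro!: arg_cong[where f = det] cong_mat)
  also have "\<dots> = (- 1) ^ m *
      det (mat (Suc m) (Suc m) (\<lambda>(k, l). M $$ (k, if l < 1 then l + m else l - 1)))"
    using det_swap_cols[of M 1 m] by (simp add: M_def)
  also have "mat (Suc m) (Suc m) (\<lambda>(k, l). M $$ (k, if l < 1 then l + m else l - 1)) =
      mat (Suc m) (Suc m) (\<lambda>(k, l). X $$ (j + k, j - 1 + l))"
    using assms by (intro eq_matI) (auto simp: M_def)
  finally have "bordered_det (\<lambda>k l. X $$ (k, l)) j i (\<lambda>k. X $$ (k, j - 1)) =
      (- 1) ^ m * det (mat (i - j) (i - j) (\<lambda>(k, l). X $$ (j + k, j - 1 + l)))"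
    by (simp only: m)
  moreover have "(- 1 :: 'a) ^ (Suc m div 2) = (- 1) ^ (m div 2) * (- 1) ^ m"
    by (cases "even m") (auto elim!: evenE oddE simp: power_add power_mult)
  ultimately show ?thesis
    using A_label_lattice_point_minor[OF assms] by (simp add: m)
qed

section \<open>Nonvanishing of the labels of the generic matrix\<close>

lemma prod_single:
  "(\<Prod>k\<in>K. Poly_Mapping.single (f k) (1 :: 'a::comm_semiring_1)) = Poly_Mapping.single (\<Sum>k\<in>K. f k) 1"
  by (induction K rule: infinite_finite_induct) (simp_all add: mult_single)

text \<open>The diagonal monomial of a determinant in distinct indeterminates has coefficient 1.\<close>

lemma det_single_nonzero:
  assumes r: "inj_on r {0..<m}" and c: "inj_on c {0..<m}"
  shows "det (mat m m (\<lambda>(k, l).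
    Poly_Mapping.single (Poly_Mapping.single (r k, c l) 1) 1 :: 'a::field xpoly)) \<noteq> 0"
    (is "det ?M \<noteq> 0")
proof -
  \<comment> \<open>The exponent vector of the Leibniz term of \<open>p\<close>.\<close>
  define mon :: "(nat \<Rightarrow> nat) \<Rightarrow> (nat \<times> nat) \<Rightarrow>\<^sub>0 nat"
    where "mon p = (\<Sum>k = 0..<m. Poly_Mapping.single (r k, c (p k)) 1)" for p
  have lookup_mon: "Poly_Mapping.lookup (mon p) a = (\<Sum>k = 0..<m. if (r k, c (p k)) = a then 1 else 0)" for p a
    unfolding mon_def lookup_sum lookup_single when_def ..
  have mon_id: "p = id" if p: "p permutes {0..<m}" and eq: "mon p = mon id" for p
  proof
    fix k
    show "p k = id k"
    proof (cases "k < m")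
      case True
      \<comment> \<open>The indeterminate at \<open>(r k, c k)\<close> divides the diagonal
        monomial, hence that of \<open>p\<close>; by injectivity of \<open>r\<close> and
        \<open>c\<close> this forces \<open>p k = k\<close>.\<close>
      have "Poly_Mapping.lookup (mon id) (r k, c k) \<noteq> 0"
        using True by (auto simp: lookup_mon)
      then have "Poly_Mapping.lookup (mon p) (r k, c k) \<noteq> 0" using eq by simp
      then obtain k' where k': "k' < m" "r k' = r k" "c (p k') = c k"
        by (auto simp: lookup_mon split: if_splits)
      then have "k' = k" using r True by (auto dest: inj_onD)
      moreover have "p k < m" using p True by (simp add: permutes_nat_less permutes_in_image)
      ultimately show ?thesis using c True k' by (auto dest: inj_onD)
    next
      case False
      then show ?thesis using p by (auto simp: permutes_def)
    qed
  qed
  have "det ?M = (\<Sum>p | p permutes {0..<m}.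
      signof p * (\<Prod>k = 0..<m. Poly_Mapping.single (Poly_Mapping.single (r k, c (p k)) 1) 1))"
    by (subst det_def'[where n = m]) (auto intro!: sum.cong prod.cong)
  also have "\<dots> = (\<Sum>p | p permutes {0..<m}. signof p * Poly_Mapping.single (mon p) 1)"
    by (simp add: prod_single mon_def)
  finally have "Poly_Mapping.lookup (det ?M) (mon id) =
      (\<Sum>p | p permutes {0..<m}. Poly_Mapping.lookup (signof p * Poly_Mapping.single (mon p) (1 :: 'a)) (mon id))"
    by (simp add: lookup_sum)
  also have "\<dots> = (\<Sum>p | p permutes {0..<m}. if p = id then 1 else 0)"
  proof (intro sum.cong refl)
    fix p assume "p \<in> {p. p permutes {0..<m}}"
    then show "Poly_Mapping.lookup (signof p * Poly_Mapping.single (mon p) (1 :: 'a)) (mon id) =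
        (if p = id then 1 else 0)"
      using mon_id[of p] by (auto simp: lookup_single when_def sign_def)
  qed
  also have "\<dots> = 1"
    by (simp add: finite_permutations permutes_id)
  finally show ?thesis by auto
qed

text \<open>The embedding of polynomials into rational functions is an injective ring homomorphism
  and so commutes with determinants.\<close>

lemma det_indet_nonzero:
  assumes "inj_on r {0..<m}" and "inj_on c {0..<m}"
  shows "det (mat m m (\<lambda>(k, l). indet (r k) (c l) :: 'a::field xratfun)) \<noteq> 0"
proof -
  define \<phi> :: "'a xpoly \<Rightarrow> 'a xratfun" where "\<phi> q = Fract q 1" for q
  interpret \<phi>: comm_ring_hom \<phi>
    by unfold_locales (simp_all add: \<phi>_def Zero_fract_def One_fract_def)
  have "mat m m (\<lambda>(k, l). indet (r k) (c l)) =
      map_mat \<phi> (mat m m (\<lambda>(k, l). Poly_Mapping.single (Poly_Mapping.single (r k, c l) 1) 1))"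
    by (intro eq_matI) (auto simp: indet_def \<phi>_def)
  moreover have "\<phi> q \<noteq> 0" if "q \<noteq> 0" for q
    using that by (simp add: \<phi>_def Zero_fract_def eq_fract)
  ultimately show ?thesis
    using det_single_nonzero[OF assms] by simp
qed

lemma generic_P_label_nonzero:
  assumes "j < i" "i \<le> Suc n"
  shows "P_label (generic_mat n :: 'a::field xratfun mat) (lattice_point i j) \<noteq> 0"
proof -
  have "mat (i - j - 1) (i - j - 1) (\<lambda>(k, l). (generic_mat n :: 'a xratfun mat) $$ (j + k, j + l)) =
      mat (i - j - 1) (i - j - 1) (\<lambda>(k, l). indet (Suc (j + k)) (Suc (j + l)))"
    by (rule eq_matI) (use assms in \<open>auto simp: generic_mat_def\<close>)
  moreover have "(generic_mat n :: 'a xratfun mat) \<in> carrier_mat n n" by (simp add: generic_mat_def)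
  ultimately show ?thesis
    using assms det_indet_nonzero[of "\<lambda>k. Suc (j + k)" "i - j - 1" "\<lambda>k. Suc (j + k)"]
    by (simp add: P_label_lattice_point principal_det_def inj_on_def)
qed

lemma generic_A_label_nonzero:
  assumes "1 \<le> j" "j < i" "i \<le> n"
  shows "A_label (generic_mat n :: 'a::field xratfun mat) (lattice_point i j) \<noteq> 0"
proof -
  have "mat (i - j) (i - j) (\<lambda>(k, l). (generic_mat n :: 'a xratfun mat) $$ (j + k, j - 1 + l)) =
      mat (i - j) (i - j) (\<lambda>(k, l). indet (Suc (j + k)) (Suc (j - 1 + l)))"
    by (rule eq_matI) (use assms in \<open>auto simp: generic_mat_def\<close>)
  moreover have "(generic_mat n :: 'a xratfun mat) \<in> carrier_mat n n" by (simp add: generic_mat_def)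
  ultimately show ?thesis
    using assms det_indet_nonzero[of "\<lambda>k. Suc (j + k)" "i - j" "\<lambda>l. Suc (j - 1 + l)"]
    by (simp add: A_label_lattice_point_minor inj_on_def)
qed

section \<open>Appending a step to a path\<close>

lemma schroeder_paths_snoc_iff:
  assumes "S \<noteq> []"
  shows "S @ [v] \<in> schroeder_paths n u w \<longleftrightarrow>
    v = w \<and> S \<in> schroeder_paths n u (last S) \<and> (last S, v) \<in> edges n"
  using assms by (auto simp: schroeder_paths_def successively_append_iff edges_def)

lemma schroeder_paths_cases:
  assumes "S \<in> schroeder_paths n u v"
  obtains "S = [u]" "u = v" "u \<in> vertices n"
  | S' w where "S = S' @ [v]" "S' \<in> schroeder_paths n u w" "(w, v) \<in> edges n"
proof (cases S rule: rev_cases)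
  case Nil
  then show ?thesis using assms by (simp add: schroeder_paths_def)
next
  case (snoc S' w)
  show ?thesis
  proof (cases "S' = []")
    case True
    then show ?thesis using assms snoc that(1) by (auto simp: schroeder_paths_def)
  next
    case False
    then show ?thesis using assms snoc that(2)[of S' "last S'"] by (auto simp: schroeder_paths_snoc_iff)
  qed
qed

lemma schroeder_paths_snoc:
  assumes "S \<in> schroeder_paths n u w" "(w, v) \<in> edges n"
  shows "S @ [v] \<in> schroeder_paths n u v"
proof -
  have "S \<noteq> []" "last S = w" using assms(1) by (auto simp: schroeder_paths_def)
  then show ?thesis using assms by (simp add: schroeder_paths_snoc_iff)
qed

lemma finite_local_extrema [simp]:
  "finite (weak_local_max S)" "finite (weak_local_min S)"
  "finite (strict_local_max S)" "finite (strict_local_min S)" "finite (horizontal_midpoints S)"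
proof -
  show "finite (weak_local_max S)"
    by (rule finite_subset[of _ "{..<length S}"]) (auto simp: weak_local_max_def)
  show "finite (weak_local_min S)"
    by (rule finite_subset[of _ "{..<length S}"]) (auto simp: weak_local_min_def)
  show "finite (strict_local_max S)"
    by (rule finite_subset[of _ "{..<length S}"]) (auto simp: strict_local_max_def)
  show "finite (strict_local_min S)"
    by (rule finite_subset[of _ "{..<length S}"]) (auto simp: strict_local_min_def)
  show "finite (horizontal_midpoints S)"
    by (rule finite_subset[of _ "(\<lambda>k. S ! k + (1, 0)) ` {..<length S}"])
      (auto simp: horizontal_midpoints_def)
qed

section \<open>Effect of an appended vertex on extrema, midpoints and weight\<close>

context
  fixes S :: "point list" and v u :: point and m :: nat
  assumes S: "length S = Suc m" and u: "u = last S"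
begin

private lemma nth_m: "S ! m = u"
  using S u by (cases S rule: rev_cases) (auto simp: nth_append)

private lemma nth_T: "k \<le> m \<Longrightarrow> (S @ [v]) ! k = S ! k" "(S @ [v]) ! Suc m = v"
  using S by (auto simp: nth_append)

lemma horizontal_midpoints_snoc:
  "horizontal_midpoints (S @ [v]) =
     horizontal_midpoints S \<union> (if v - u = (2, 0) then {u + (1, 0)} else {})"
proof (rule Set.set_eqI)
  fix h
  have "h \<in> horizontal_midpoints (S @ [v]) \<longleftrightarrow>
      (\<exists>k<Suc m. h = (S @ [v]) ! k + (1, 0) \<and> (S @ [v]) ! Suc k - (S @ [v]) ! k = (2, 0))"
    by (simp only: horizontal_midpoints_def mem_Collect_eq length_append_singleton S
        Suc_eq_plus1[symmetric] Suc_less_eq) blast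
  also have "\<dots> \<longleftrightarrow> h = u + (1, 0) \<and> v - u = (2, 0) \<or>
      (\<exists>k<m. h = S ! k + (1, 0) \<and> S ! Suc k - S ! k = (2, 0))"
    unfolding Ex_less_Suc by (simp add: nth_T nth_m cong: conj_cong)
  also have "(\<exists>k<m. h = S ! k + (1, 0) \<and> S ! Suc k - S ! k = (2, 0)) \<longleftrightarrow> h \<in> horizontal_midpoints S"
    by (simp only: horizontal_midpoints_def mem_Collect_eq S Suc_eq_plus1[symmetric] Suc_less_eq)
      blast
  finally show "h \<in> horizontal_midpoints (S @ [v]) \<longleftrightarrow>
      h \<in> horizontal_midpoints S \<union> (if v - u = (2, 0) then {u + (1, 0)} else {})"
    by (simp only: Un_iff split: if_split) blast
qed

text \<open>Among the old indices only \<open>m\<close> gets a new neighbour.\<close>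

lemma weak_local_max_snoc:
  "weak_local_max (S @ [v]) =
     (if snd v \<le> snd u then weak_local_max S else weak_local_max S - {m}) \<union>
     (if snd u \<le> snd v then {Suc m} else {})" (is "_ = ?R")
proof (rule Set.set_eqI)
  fix k
  consider "k < m" | "k = m" | "k = Suc m" | "k > Suc m" by linarith
  then show "k \<in> weak_local_max (S @ [v]) \<longleftrightarrow> k \<in> ?R"
    by cases (auto simp: weak_local_max_def S nth_T nth_m)
qed

lemma weak_local_min_snoc:
  "weak_local_min (S @ [v]) =
     (if snd u \<le> snd v then weak_local_min S else weak_local_min S - {m}) \<union>
     (if snd v \<le> snd u then {Suc m} else {})" (is "_ = ?R")
proof (rule Set.set_eqI)
  fix k
  consider "k < m" | "k = m" | "k = Suc m" | "k > Suc m" by linarith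
  then show "k \<in> weak_local_min (S @ [v]) \<longleftrightarrow> k \<in> ?R"
    by cases (auto simp: weak_local_min_def S nth_T nth_m)
qed

text \<open>At the last index, not being a weak minimum means having a strictly lower predecessor.
  In this form the condition is complementary to the one under which a descent removes
  \<open>m\<close> from the weak minima.\<close>

lemma strict_local_max_snoc:
  "strict_local_max (S @ [v]) =
     strict_local_max S \<union> (if snd v < snd u \<and> m \<notin> weak_local_min S then {m} else {})" (is "_ = ?R")
proof (rule Set.set_eqI)
  fix k
  consider "k < m" | "k = m" | "k = Suc m" | "k > Suc m" by linarith
  then show "k \<in> strict_local_max (S @ [v]) \<longleftrightarrow> k \<in> ?R"
    by cases (auto simp: strict_local_max_def weak_local_min_def S nth_T nth_m)
qed

lemma strict_local_min_snoc:
  "strict_local_min (S @ [v]) =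
     strict_local_min S \<union> (if snd u < snd v \<and> m \<notin> weak_local_max S then {m} else {})" (is "_ = ?R")
proof (rule Set.set_eqI)
  fix k
  consider "k < m" | "k = m" | "k = Suc m" | "k > Suc m" by linarith
  then show "k \<in> strict_local_min (S @ [v]) \<longleftrightarrow> k \<in> ?R"
    by cases (auto simp: strict_local_min_def weak_local_max_def S nth_T nth_m)
qed

private lemma index_bounds:
  "Suc m \<notin> weak_local_max S" "Suc m \<notin> weak_local_min S"
  "m \<notin> strict_local_max S" "m \<notin> strict_local_min S"
  by (auto simp: weak_local_max_def weak_local_min_def strict_local_max_def strict_local_min_def S)

private lemma prod_old: "K \<subseteq> {..m} \<Longrightarrow> (\<Prod>k\<in>K. f ((S @ [v]) ! k)) = (\<Prod>k\<in>K. f (S ! k))"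
  by (intro prod.cong) (auto simp: nth_T)

private lemma index_le:
  "weak_local_max S \<subseteq> {..m}" "weak_local_min S \<subseteq> {..m}"
  "strict_local_max S \<subseteq> {..m}" "strict_local_min S \<subseteq> {..m}"
  "weak_local_max S - {m} \<subseteq> {..m}" "weak_local_min S - {m} \<subseteq> {..m}"
  by (auto simp: weak_local_max_def weak_local_min_def strict_local_max_def strict_local_min_def S)

text \<open>The new end is a weak maximum. Its predecessor either stops being a weak maximum, so
  that \<open>A_label X u\<close> leaves the numerator, or becomes a strict minimum, so that
  \<open>A_label X u\<close> enters the denominator.\<close>

lemma weight_snoc_up:
  assumes "snd u < snd v" and "A_label X u \<noteq> 0"
  shows "weight X (S @ [v]) = weight X S * A_label X v / A_label X u"
proof (cases "m \<in> weak_local_max S")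
  case True
  have ne: "v - u \<noteq> (2, 0)" using assms(1) by (auto simp: prod_eq_iff)
  have "(\<Prod>k\<in>weak_local_max S. A_label X (S ! k)) =
      A_label X u * (\<Prod>k\<in>weak_local_max S - {m}. A_label X (S ! k))"
    by (subst prod.remove[of _ m]) (simp_all add: True nth_m)
  with True ne assms show ?thesis
    by (simp add: weight_def weight_num_def weight_denom_def weak_local_max_snoc
        weak_local_min_snoc strict_local_max_snoc strict_local_min_snoc horizontal_midpoints_snoc
        index_bounds prod_old index_le nth_T ac_simps)
next
  case False
  have ne: "v - u \<noteq> (2, 0)" using assms(1) by (auto simp: prod_eq_iff)
  with False ne assms show ?thesis
    by (simp add: weight_def weight_num_def weight_denom_def weak_local_max_snoc
        weak_local_min_snoc strict_local_max_snoc strict_local_min_snoc horizontal_midpoints_snoc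
        index_bounds prod_old index_le nth_T ac_simps nth_m)
qed

text \<open>Dual to the step up: \<open>P_label X u\<close> leaves the numerator or enters the
  denominator.\<close>

lemma weight_snoc_down:
  assumes "snd v < snd u" and "P_label X u \<noteq> 0"
  shows "weight X (S @ [v]) = weight X S * P_label X v / P_label X u"
proof (cases "m \<in> weak_local_min S")
  case True
  have ne: "v - u \<noteq> (2, 0)" using assms(1) by (auto simp: prod_eq_iff)
  have "(\<Prod>k\<in>weak_local_min S. P_label X (S ! k)) =
      P_label X u * (\<Prod>k\<in>weak_local_min S - {m}. P_label X (S ! k))"
    by (subst prod.remove[of _ m]) (simp_all add: True nth_m)
  with True ne assms show ?thesis
    by (simp add: weight_def weight_num_def weight_denom_def weak_local_max_snoc
        weak_local_min_snoc strict_local_max_snoc strict_local_min_snoc horizontal_midpoints_snoc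
        index_bounds prod_old index_le nth_T ac_simps)
next
  case False
  have ne: "v - u \<noteq> (2, 0)" using assms(1) by (auto simp: prod_eq_iff)
  with False ne assms show ?thesis
    by (simp add: weight_def weight_num_def weight_denom_def weak_local_max_snoc
        weak_local_min_snoc strict_local_max_snoc strict_local_min_snoc horizontal_midpoints_snoc
        index_bounds prod_old index_le nth_T ac_simps nth_m)
qed

text \<open>The old end keeps its status and the new end is a weak maximum and a weak minimum at
  once. Midpoints form a set, so the new one must be fresh to contribute its factors.\<close>

lemma weight_snoc_horizontal:
  assumes "v - u = (2, 0)" and "u + (1, 0) \<notin> horizontal_midpoints S"
  shows "weight X (S @ [v]) = weight X S * A_label X v * P_label X v /
    (P_label X (u + (1, 1)) * (if 1 \<le> snd u then A_label X (u + (1, -1)) else 1))"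
proof -
  let ?H = "horizontal_midpoints S" and ?h = "u + (1, 0)"
  have v: "snd v = snd u" using assms(1) by (auto simp: prod_eq_iff)
  have H: "horizontal_midpoints (S @ [v]) = insert ?h ?H"
    using assms(1) by (simp add: horizontal_midpoints_snoc)
  have shift: "?h + (0, 1) = u + (1, 1)" "?h - (0, 1) = u + (1, -1)"
    by (auto simp: prod_eq_iff)
  have P: "(\<Prod>h\<in>insert ?h ?H. P_label X (h + (0, 1))) =
      P_label X (u + (1, 1)) * (\<Prod>h\<in>?H. P_label X (h + (0, 1)))"
    using assms(2) by (simp add: shift(1))
  have "{h \<in> insert ?h ?H. 1 \<le> snd h} =
      (if 1 \<le> snd u then insert ?h {h \<in> ?H. 1 \<le> snd h} else {h \<in> ?H. 1 \<le> snd h})"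
    by auto
  then have A: "(\<Prod>h\<in>{h \<in> insert ?h ?H. 1 \<le> snd h}. A_label X (h - (0, 1))) =
      (if 1 \<le> snd u then A_label X (u + (1, -1)) else 1) *
      (\<Prod>h\<in>{h \<in> ?H. 1 \<le> snd h}. A_label X (h - (0, 1)))"
    using assms(2) by (simp add: shift(2))
  have "weight_num X (S @ [v]) = weight_num X S * A_label X v * P_label X v"
    by (simp add: weight_num_def weak_local_max_snoc weak_local_min_snoc v index_bounds prod_old
        index_le nth_T)
  moreover have "weight_denom X (S @ [v]) = weight_denom X S *
      (P_label X (u + (1, 1)) * (if 1 \<le> snd u then A_label X (u + (1, -1)) else 1))"
    by (simp only: weight_denom_def H P A)
      (simp add: strict_local_max_snoc strict_local_min_snoc v prod_old index_le)
  ultimately show ?thesis by (simp add: weight_def)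
qed

end

text \<open>Shows that the midpoint of an appended horizontal step is fresh: it lies to the right of
  the old end.\<close>

lemma schroeder_path_fst_less:
  assumes "S \<in> schroeder_paths n u v" "h \<in> horizontal_midpoints S"
  shows "fst h < fst v"
proof -
  obtain k where k: "k + 1 < length S" "S ! (k + 1) - S ! k = (2, 0)" "h = S ! k + (1, 0)"
    using assms(2) by (auto simp: horizontal_midpoints_def)
  have "fst h < fst (S ! (k + 1))" using k by (auto simp: prod_eq_iff)
  also have "\<dots> \<le> fst (S ! (length S - 1))"
  proof (cases "k + 1 = length S - 1")
    case False
    have "sorted_wrt (\<lambda>a b. fst a < fst b) S"
      by (rule path_sorted[of n]) (use assms(1) in \<open>simp add: schroeder_paths_def\<close>)
    moreover have "k + 1 < length S - 1" "length S - 1 < length S" using k(1) False by auto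
    ultimately show ?thesis by (meson less_imp_le sorted_wrt_nth_less)
  qed simp
  also have "S ! (length S - 1) = v"
    using assms(1) by (auto simp: schroeder_paths_def last_conv_nth)
  finally show ?thesis .
qed

section \<open>Paths ending at a given vertex\<close>

lemma edges_lattice_point_iff:
  "(lattice_point i j, lattice_point i' j') \<in> edges n \<longleftrightarrow>
     lattice_point i j \<in> vertices n \<and> lattice_point i' j' \<in> vertices n \<and>
     (i' = Suc i \<and> j' = j \<or> i' = i \<and> j' = Suc j \<or> i' = Suc i \<and> j' = Suc j)"
  unfolding edges_def by (auto simp: lattice_point_def)

lemma edges_into_lattice_point:
  assumes "(w, lattice_point i j) \<in> edges n"
  obtains i' j' where "w = lattice_point i' j'" "i = Suc i' \<and> j = j' \<or> i = i' \<and> j = Suc j' \<or> i = Suc i' \<and> j = Suc j'"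
proof -
  have "w \<in> vertices n" using assms by (auto simp: edges_def)
  then obtain i' j' where "w = lattice_point i' j'" by (rule vertices_cases)
  then show ?thesis using assms that by (simp add: edges_lattice_point_iff)
qed

lemma schroeder_paths_empty:
  assumes "v \<notin> vertices n"
  shows "schroeder_paths n u v = {}"
  using assms by (auto simp: schroeder_paths_def dest: last_in_set)

text \<open>No step lowers \<open>j\<close>, which equals \<open>a\<close> at the start.\<close>

lemma schroeder_paths_node_le:
  assumes "S \<in> schroeder_paths n (node a) (lattice_point i j)"
  shows "a \<le> j"
  using assms
proof (induction "i + j" arbitrary: i j S rule: less_induct)
  case less
  from less.prems show ?case
  proof (cases rule: schroeder_paths_cases)
    case 1
    then show ?thesis by (simp add: node_eq_lattice_point)
  next
    case (2 S' w)
    obtain i' j' where w: "w = lattice_point i' j'"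
      and ij: "i = Suc i' \<and> j = j' \<or> i = i' \<and> j = Suc j' \<or> i = Suc i' \<and> j = Suc j'"
      using 2(3) by (rule edges_into_lattice_point)
    have "a \<le> j'" using less.hyps[of i' j' S'] 2(2) w ij by auto
    then show ?thesis using ij by auto
  qed
qed

text \<open>Classifies paths by their last step; \<open>u\<close> differing from the end excludes
  the one-vertex path. A predecessor outside the graph contributes an empty sum.\<close>

lemma sum_schroeder_paths:
  assumes "u \<noteq> lattice_point (Suc i) (Suc j)" "j < i" "i < n"
  shows "(\<Sum>S\<in>schroeder_paths n u (lattice_point (Suc i) (Suc j)). f S) =
    (\<Sum>S\<in>schroeder_paths n u (lattice_point i (Suc j)). f (S @ [lattice_point (Suc i) (Suc j)])) +
    (\<Sum>S\<in>schroeder_paths n u (lattice_point i j). f (S @ [lattice_point (Suc i) (Suc j)])) +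
    (\<Sum>S\<in>schroeder_paths n u (lattice_point (Suc i) j). f (S @ [lattice_point (Suc i) (Suc j)]))"
proof -
  let ?v = "lattice_point (Suc i) (Suc j)" and ?g = "\<lambda>S. S @ [lattice_point (Suc i) (Suc j)]"
  let ?P = "schroeder_paths n u"
  have v: "?v \<in> vertices n" using assms by (simp add: lattice_point_in_vertices_iff)
  have edge: "(lattice_point i' j', ?v) \<in> edges n"
    if "S \<in> ?P (lattice_point i' j')"
       "(i', j') \<in> {(i, Suc j), (i, j), (Suc i, j)}" for S i' j'
  proof -
    have "lattice_point i' j' \<in> vertices n"
      using that(1) schroeder_paths_empty by blast
    then show ?thesis using that(2) v by (auto simp: edges_lattice_point_iff)
  qed
  have "?P ?v = ?g ` ?P (lattice_point i (Suc j)) \<union> ?g ` ?P (lattice_point i j) \<union>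
      ?g ` ?P (lattice_point (Suc i) j)" (is "_ = ?R")
  proof
    show "?P ?v \<subseteq> ?R"
    proof
      fix S assume "S \<in> ?P ?v"
      then show "S \<in> ?R"
      proof (cases rule: schroeder_paths_cases)
        case 1
        then show ?thesis using assms(1) by simp
      next
        case (2 S' w)
        from 2(3) show ?thesis
          by (rule edges_into_lattice_point) (use 2 in auto)
      qed
    qed
    show "?R \<subseteq> ?P ?v"
      using edge by (auto intro!: schroeder_paths_snoc)
  qed
  moreover have "?g ` ?P w \<inter> ?g ` ?P w' = {}" if "w \<noteq> w'" for w w'
    using that by (auto simp: schroeder_paths_def)
  moreover have "(\<Sum>S\<in>?g ` ?P w. f S) = (\<Sum>S\<in>?P w. f (?g S))" for w
    by (subst sum.reindex) (auto simp: inj_on_def)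
  ultimately show ?thesis
    by (simp add: sum.union_disjoint finite_schroeder_paths Int_Un_distrib2)
qed

section \<open>Paths that only rise, the base case \<open>j = a\<close>\<close>

definition rising_path :: "nat \<Rightarrow> nat \<Rightarrow> point list" where
  "rising_path a i = map (\<lambda>k. lattice_point k a) [Suc a..<Suc i]"

lemma rising_path_Suc: "a < i \<Longrightarrow> rising_path a (Suc i) = rising_path a i @ [lattice_point (Suc i) a]"
  by (simp add: rising_path_def)

lemma rising_path_in_schroeder_paths:
  assumes "1 \<le> a" "a < i" "i \<le> n"
  shows "rising_path a i \<in> schroeder_paths n (node a) (lattice_point i a)"
  using assms(2,3)
proof (induction i)
  case (Suc i)
  show ?case
  proof (cases "i = a")
    case True
    then show ?thesis using assms Suc.prems
      by (auto simp: rising_path_def schroeder_paths_def node_eq_lattice_point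
          lattice_point_in_vertices_iff)
  next
    case False
    then show ?thesis using assms Suc
      by (auto simp: rising_path_Suc edges_lattice_point_iff lattice_point_in_vertices_iff
          intro!: schroeder_paths_snoc)
  qed
qed simp

text \<open>Since \<open>j\<close> never decreases and ends at its initial value \<open>a\<close>,
  every step must be a step up.\<close>

lemma schroeder_paths_rising:
  assumes "1 \<le> a" "a < i" "i \<le> n"
  shows "schroeder_paths n (node a) (lattice_point i a) = {rising_path a i}"
proof -
  have "S = rising_path a i" if "S \<in> schroeder_paths n (node a) (lattice_point i a)" for S
    using that assms(2)
  proof (induction i arbitrary: S)
    case (Suc i)
    from Suc.prems(1) show ?case
    proof (cases rule: schroeder_paths_cases)
      case 1
      then show ?thesis by (simp add: node_eq_lattice_point rising_path_def)
    next
      case (2 S' w)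
      from 2(3) obtain i' j' where w: "w = lattice_point i' j'"
        and ij: "Suc i = Suc i' \<and> a = j' \<or> Suc i = i' \<and> a = Suc j' \<or> Suc i = Suc i' \<and> a = Suc j'"
        by (rule edges_into_lattice_point)
      have "a \<le> j'" using 2(2) w schroeder_paths_node_le by blast
      then have *: "i' = i" "j' = a" using ij by auto
      have "lattice_point i a \<in> vertices n" using 2(3) w * by (auto simp: edges_def)
      then have "a < i" by (simp add: lattice_point_in_vertices_iff)
      then show ?thesis using Suc.IH[of S'] 2 w * by (simp add: rising_path_Suc)
    qed
  qed simp
  then show ?thesis using rising_path_in_schroeder_paths[OF assms] by blast
qed

lemma P_label_node [simp]: "P_label X (node a) = 1"
proof -
  have "{a<..<Suc a} = {}" by auto
  then have "P_label X (node a) = det (submatrix X {} {})"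
    by (simp add: P_label_def I_of_def node_eq_lattice_point p_minor_def minor_def)
  moreover have "submatrix X {} {} \<in> carrier_mat 0 0"
    by (simp add: submatrix_def)
  ultimately show ?thesis by simp
qed

text \<open>The heights increase strictly: the only weak minimum is the start, with label 1, the
  only weak maximum is the end, and the denominator is empty.\<close>

lemma weight_rising_path:
  assumes "a < i"
  shows "weight X (rising_path a i) = A_label X (lattice_point i a)"
proof -
  let ?S = "rising_path a i"
  have len: "length ?S = i - a" using assms by (simp add: rising_path_def Suc_diff_le)
  have nth: "?S ! k = lattice_point (Suc (a + k)) a" if "k < i - a" for k
    using that unfolding rising_path_def by (subst nth_map) (auto simp del: upt_Suc)
  have "weak_local_max ?S = {i - a - 1}"
    using assms by (auto simp: weak_local_max_def len nth not_less)
  moreover have "weak_local_min ?S = {0}"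
    using assms by (auto simp: weak_local_min_def len nth)
  moreover have "strict_local_max ?S = {}" "strict_local_min ?S = {}"
    by (auto simp: strict_local_max_def strict_local_min_def len nth)
  moreover have "horizontal_midpoints ?S = {}"
    by (auto simp: horizontal_midpoints_def len nth) (simp add: lattice_point_def)
  ultimately show ?thesis
    using assms by (simp add: weight_def weight_num_def weight_denom_def nth
        node_eq_lattice_point[symmetric])
qed

section \<open>Labels forced to be nonzero by the denominators of complete paths\<close>

lemma schroeder_path_exists:
  assumes "1 \<le> a" "a \<le> j" "j < i" "i \<le> n"
  shows "\<exists>S. S \<in> schroeder_paths n (node a) (lattice_point i j)"
  using assms(2,3)
proof (induction j rule: dec_induct)
  case base
  then show ?case using rising_path_in_schroeder_paths[of a i n] assms by blast
next
  case (step j)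
  then obtain S where "S \<in> schroeder_paths n (node a) (lattice_point i j)" by auto
  then have "S @ [lattice_point i (Suc j)] \<in> schroeder_paths n (node a) (lattice_point i (Suc j))"
    by (rule schroeder_paths_snoc)
      (use assms step in \<open>simp add: edges_lattice_point_iff lattice_point_in_vertices_iff\<close>)
  then show ?case by blast
qed

text \<open>Go up to \<open>(b, j)\<close>, then down to \<open>(b, b - 1)\<close>, which is node
  \<open>b - 1\<close>. This makes any partial path part of a complete one.\<close>

lemma schroeder_path_extension:
  assumes "S \<in> schroeder_paths n u (lattice_point i j)" "i \<le> b" "b \<le> n"
  shows "\<exists>T. S @ T \<in> schroeder_paths n u (lattice_point b (b - 1))"
proof -
  have v: "1 \<le> j" "j < i"
    using assms(1) schroeder_paths_empty[of "lattice_point i j" n u]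
    by (auto simp: lattice_point_in_vertices_iff)
  have up: "\<exists>T. S @ T \<in> schroeder_paths n u (lattice_point b j)"
    using assms(2,3)
  proof (induction b rule: dec_induct)
    case base
    then show ?case using assms(1) by (intro exI[of _ "[]"]) simp
  next
    case (step b)
    then obtain T where "S @ T \<in> schroeder_paths n u (lattice_point b j)" by auto
    then have "(S @ T) @ [lattice_point (Suc b) j] \<in> schroeder_paths n u (lattice_point (Suc b) j)"
      by (rule schroeder_paths_snoc)
        (use v step in \<open>simp add: edges_lattice_point_iff lattice_point_in_vertices_iff\<close>)
    then show ?case by auto
  qed
  have "\<exists>T. S @ T \<in> schroeder_paths n u (lattice_point b k)" if "j \<le> k" "k < b" for k
    using that
  proof (induction k rule: dec_induct)
    case base
    then show ?case using up by simp
  next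
    case (step k)
    then obtain T where "S @ T \<in> schroeder_paths n u (lattice_point b k)" by auto
    then have "(S @ T) @ [lattice_point b (Suc k)] \<in> schroeder_paths n u (lattice_point b (Suc k))"
      by (rule schroeder_paths_snoc)
        (use v step assms(3) in \<open>simp add: edges_lattice_point_iff lattice_point_in_vertices_iff\<close>)
    then show ?case by auto
  qed
  then show ?thesis using v assms(2) by simp
qed

lemma horizontal_midpoints_append: "horizontal_midpoints S \<subseteq> horizontal_midpoints (S @ T)"
proof
  fix h assume "h \<in> horizontal_midpoints S"
  then obtain k where "k + 1 < length S" "S ! (k + 1) - S ! k = (2, 0)" "h = S ! k + (1, 0)"
    by (auto simp: horizontal_midpoints_def)
  then show "h \<in> horizontal_midpoints (S @ T)"
    unfolding horizontal_midpoints_def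
    by (intro CollectI exI[of _ k]) (simp add: nth_append)
qed

text \<open>
  Both labels sit next to the horizontal step from \<open>(s, q)\<close> to \<open>(s + 1, q + 1)\<close>, which lies on
  some path between the two nodes.
\<close>

lemma labels_nonzero:
  assumes "1 \<le> a" "a \<le> q" "q < s" "s < b" "b \<le> n"
    and H: "\<And>S. S \<in> schroeder_paths n (node a) (node (b - 1)) \<Longrightarrow> weight_denom X S \<noteq> 0"
  shows "P_label X (lattice_point (Suc s) q) \<noteq> 0"
    and "Suc q < s \<Longrightarrow> A_label X (lattice_point s (Suc q)) \<noteq> 0"
proof -
  obtain S0 where S0: "S0 \<in> schroeder_paths n (node a) (lattice_point s q)"
    using schroeder_path_exists[of a q s n] assms by auto
  let ?S1 = "S0 @ [lattice_point (Suc s) (Suc q)]"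
  have S1: "?S1 \<in> schroeder_paths n (node a) (lattice_point (Suc s) (Suc q))"
    using S0 by (rule schroeder_paths_snoc)
      (use assms in \<open>simp add: edges_lattice_point_iff lattice_point_in_vertices_iff\<close>)
  obtain T where "?S1 @ T \<in> schroeder_paths n (node a) (lattice_point b (b - 1))"
    using schroeder_path_extension[OF S1, of b] assms by auto
  then have "?S1 @ T \<in> schroeder_paths n (node a) (node (b - 1))"
    using assms by (simp add: node_eq_lattice_point)
  then have W: "weight_denom X (?S1 @ T) \<noteq> 0" by (rule H)
  let ?h = "lattice_point s q + (1, 0)"
  have "length S0 = Suc (length S0 - 1)" "lattice_point s q = last S0"
    using S0 by (auto simp: schroeder_paths_def)
  from horizontal_midpoints_snoc[OF this, of "lattice_point (Suc s) (Suc q)"]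
  have "?h \<in> horizontal_midpoints ?S1"
    by (simp add: lattice_point_def)
  then have h: "?h \<in> horizontal_midpoints (?S1 @ T)"
    using horizontal_midpoints_append by blast
  have "P_label X (?h + (0, 1)) \<noteq> 0"
    using W h by (auto simp: weight_denom_def)
  moreover have "?h + (0, 1) = lattice_point (Suc s) q" by (simp add: lattice_point_def)
  ultimately show "P_label X (lattice_point (Suc s) q) \<noteq> 0" by simp
  show "A_label X (lattice_point s (Suc q)) \<noteq> 0" if "Suc q < s"
  proof -
    let ?K = "{h \<in> horizontal_midpoints (?S1 @ T). 1 \<le> snd h}"
    \<comment> \<open>\<open>Suc q < s\<close> says that the horizontal step lies above the axis,
      where the denominator has the \<open>A\<close> factor.\<close>
    have "?h \<in> ?K" using h that by simp
    moreover have "(\<Prod>h\<in>?K. A_label X (h - (0, 1))) \<noteq> 0"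
      using W by (simp only: weight_denom_def mult_eq_0_iff de_Morgan_disj not_False_eq_True)
    moreover have "finite ?K" by simp
    ultimately have "A_label X (?h - (0, 1)) \<noteq> 0"
      using prod_zero[of ?K "\<lambda>h. A_label X (h - (0, 1))"] by blast
    moreover have "?h - (0, 1) = lattice_point s (Suc q)" by (simp add: lattice_point_def)
    ultimately show ?thesis by simp
  qed
qed

section \<open>The path sums\<close>

text \<open>Induction along the graph. The steps into \<open>(Suc s, Suc q)\<close> divide only by
  the labels \<open>P\<close> at \<open>(Suc s, q)\<close> and \<open>A\<close> at
  \<open>(s, Suc q)\<close>, the ones assumed to be nonzero.\<close>

lemma sum_weight_lattice_point:
  fixes X :: "'a::field mat"
  assumes X: "X \<in> carrier_mat n n" and a: "1 \<le> a" and b: "b \<le> n"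
    and P: "\<And>q s. a \<le> q \<Longrightarrow> q < s \<Longrightarrow> s < b \<Longrightarrow> P_label X (lattice_point (Suc s) q) \<noteq> 0"
    and A: "\<And>q s. a \<le> q \<Longrightarrow> Suc q < s \<Longrightarrow> s < b \<Longrightarrow> A_label X (lattice_point s (Suc q)) \<noteq> 0"
    and "a \<le> j" "j < i" "i \<le> b"
  shows "(\<Sum>S\<in>schroeder_paths n (node a) (lattice_point i j). weight X S) =
    (- 1) ^ ((i - j - 1) div 2) * bordered_det (\<lambda>k l. X $$ (k, l)) j i (\<lambda>k. X $$ (k, a - 1))"
  using assms(6-)
proof (induction "i + j" arbitrary: i j rule: less_induct)
  case less
  define G where "G i j = (\<Sum>S\<in>schroeder_paths n (node a) (lattice_point i j). weight X S)" for i j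
  define x where "x = (\<lambda>k l. X $$ (k, l))"
  define u where "u = (\<lambda>k. X $$ (k, a - 1))"
  have IH: "G i' j' = (- 1) ^ ((i' - j' - 1) div 2) * bordered_det x j' i' u"
    if "i' + j' < i + j" "a \<le> j'" "j' < i'" "i' \<le> b" for i' j'
    using less.hyps[OF that] by (simp add: G_def x_def u_def)
  show ?case
  proof (cases "j = a")
    case True
    then show ?thesis
      using less.prems a b X
      by (simp add: schroeder_paths_rising weight_rising_path A_label_lattice_point)
  next
    case False
    \<comment> \<open>The possible predecessors of \<open>(i, j)\<close> are then
      \<open>(s, Suc q)\<close>, \<open>(s, q)\<close> and \<open>(Suc s, q)\<close>.\<close>
    define q s where "q = j - 1" and "s = i - 1"
    have ij: "j = Suc q" "i = Suc s" and qs: "a \<le> q" "q < s" "s < b" "s < n"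
      using False less.prems a b by (auto simp: q_def s_def)
    let ?v = "lattice_point (Suc s) (Suc q)"
    let ?A = "A_label X ?v" and ?P = "P_label X ?v"
      and ?A' = "A_label X (lattice_point s (Suc q))" and ?P' = "P_label X (lattice_point (Suc s) q)"
    have path: "length S = Suc (length S - 1)" "w = last S"
      if "S \<in> schroeder_paths n (node a) w" for S w
      using that by (auto simp: schroeder_paths_def)
    have ends: "node a \<noteq> ?v" using qs(1) by (simp add: node_eq_lattice_point)
    have flat: "weight X (S @ [?v]) =
        weight X S * (?A * ?P / (?P' * (if Suc q < s then ?A' else 1)))"
      if S: "S \<in> schroeder_paths n (node a) (lattice_point s q)" for S
    proof -
      have "lattice_point s q + (1, 1) = lattice_point (Suc s) q"
        "lattice_point s q + (1, -1) = lattice_point s (Suc q)"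
        "?v - lattice_point s q = (2, 0)"
        by (simp_all add: lattice_point_def)
      moreover have "lattice_point s q + (1, 0) \<notin> horizontal_midpoints S"
        using schroeder_path_fst_less[OF S] by fastforce
      moreover have "1 \<le> snd (lattice_point s q) \<longleftrightarrow> Suc q < s" by auto
      ultimately show ?thesis using weight_snoc_horizontal[OF path[OF S], of ?v X] by simp
    qed
    have down: "weight X (S @ [?v]) = weight X S * (?P / ?P')"
      if S: "S \<in> schroeder_paths n (node a) (lattice_point (Suc s) q)" for S
      using weight_snoc_down[OF path[OF S], of ?v X] P qs by simp
    have up: "weight X (S @ [?v]) = weight X S * (?A / ?A')"
      if S: "S \<in> schroeder_paths n (node a) (lattice_point s (Suc q))" "Suc q < s" for S
      using weight_snoc_up[OF path[OF S(1)], of ?v X] A qs S(2) by simp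
    \<comment> \<open>For \<open>s = Suc q\<close> the vertex \<open>?v\<close> lies on the axis: no
      step goes up into it, and the horizontal step into it has no \<open>A\<close> label in its
      denominator.\<close>
    have rec: "G (Suc s) (Suc q) = (if Suc q < s then G s (Suc q) * (?A / ?A') else 0) +
        G s q * (?A * ?P / (?P' * (if Suc q < s then ?A' else 1))) + G (Suc s) q * (?P / ?P')"
    proof -
      have "(\<Sum>S\<in>schroeder_paths n (node a) (lattice_point s (Suc q)). weight X (S @ [?v])) =
          (if Suc q < s then G s (Suc q) * (?A / ?A') else 0)"
      proof (cases "Suc q < s")
        case True
        then show ?thesis unfolding G_def sum_distrib_right by (simp add: up cong: sum.cong)
      next
        case False
        then show ?thesis
          by (simp add: schroeder_paths_empty lattice_point_in_vertices_iff)
      qed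
      moreover have "(\<Sum>S\<in>schroeder_paths n (node a) (lattice_point s q). weight X (S @ [?v])) =
          G s q * (?A * ?P / (?P' * (if Suc q < s then ?A' else 1)))"
        unfolding G_def sum_distrib_right by (intro sum.cong refl flat)
      moreover have "(\<Sum>S\<in>schroeder_paths n (node a) (lattice_point (Suc s) q). weight X (S @ [?v])) =
          G (Suc s) q * (?P / ?P')"
        unfolding G_def sum_distrib_right by (intro sum.cong refl down)
      ultimately show ?thesis
        unfolding G_def[of "Suc s"] using sum_schroeder_paths[OF ends qs(2,4), of "weight X"] by simp
    qed
    let ?p = "principal_det x (Suc q) (s - Suc q)" and ?p' = "principal_det x q (s - q)"
    let ?B = "bordered_det x (Suc q) (Suc s) (\<lambda>k. x k q)"
      and ?B' = "bordered_det x (Suc q) s (\<lambda>k. x k q)"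
    \<comment> \<open>The sign \<open>c\<close> belongs to both \<open>?v\<close> and
      \<open>(s, q)\<close>, which share the difference \<open>i - j\<close>; \<open>d\<close>
      belongs to \<open>(Suc s, q)\<close>.\<close>
    define c :: 'a where "c = (- 1) ^ ((s - q - 1) div 2)"
    define d :: 'a where "d = (- 1) ^ ((s - q) div 2)"
    have A_eq: "?A = c * ?B" and P_eq: "?P = c * ?p" and P'_eq: "?P' = d * ?p'"
      using A_label_lattice_point[OF X, of "Suc q" "Suc s"] P_label_lattice_point[OF X, of "Suc q" "Suc s"]
        P_label_lattice_point[OF X, of q "Suc s"] qs
      by (simp_all add: c_def d_def x_def Suc_diff_le)
    have G1: "G s q = c * bordered_det x q s u" and G2: "G (Suc s) q = d * bordered_det x q (Suc s) u"
      using IH[of s q] IH[of "Suc s" q] qs ij by (simp_all add: c_def d_def Suc_diff_le)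
    have p': "?p' \<noteq> 0" using P[of q s] qs P'_eq by auto
    have "G (Suc s) (Suc q) = c * bordered_det x (Suc q) (Suc s) u"
    proof (cases "Suc q < s")
      case True
      define m where "m = s - q - 2"
      have m: "s - q = Suc (Suc m)" using True by (simp add: m_def)
      define e :: 'a where "e = (- 1) ^ (m div 2)"
      \<comment> \<open>Hence \<open>d * e = - 1\<close>, which produces the minus sign of the
        horizontal term in \<open>bordered_det_recurrence\<close>.\<close>
      have d: "d = - e" by (simp add: d_def e_def m)
      have A'_eq: "?A' = e * ?B'" and G3: "G s (Suc q) = e * bordered_det x (Suc q) s u"
        using A_label_lattice_point[OF X, of "Suc q" s] IH[of s "Suc q"] True qs ij
        by (simp_all add: e_def m_def x_def numeral_2_eq_2)
      have B': "?B' \<noteq> 0" using A[of q s] True qs A'_eq by auto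
      have sgn: "c = 1 \<or> c = - 1" "e = 1 \<or> e = - 1"
        by (simp_all add: c_def e_def minus_one_power_iff)
      have "bordered_det x (Suc q) (Suc s) u = bordered_det x (Suc q) s u * ?B / ?B' -
          bordered_det x q s u * ?B * ?p / (?p' * ?B') + bordered_det x q (Suc s) u * ?p / ?p'"
        using bordered_det_recurrence[OF True p', of u] p' B' by (simp add: field_simps)
      with sgn show ?thesis
        unfolding rec A_eq P_eq P'_eq A'_eq G1 G2 G3 d using True
        by (elim disjE) (simp_all add: algebra_simps)
    next
      case False
      then have s: "s = Suc q" using qs by simp
      have "?p' = x q q" "?p = 1" "c = 1" "d = 1"
        by (simp_all add: s c_def d_def principal_det_def det_single)
      then show ?thesis
        unfolding rec A_eq P_eq P'_eq G1 G2
        using bordered_det_recurrence_bottom[of x q u] p' by (simp add: s field_simps)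
    qed
    then show ?thesis
      by (simp add: ij G_def c_def x_def u_def)
  qed
qed

text \<open>Node \<open>i - 1\<close> is the vertex \<open>(i, i - 1)\<close>, where the sign is 1
  and the bordered determinant has size 1. Stated over any field, it applies to generic and to
  concrete matrices.\<close>

lemma matrix_entry_eq_sum_weight:
  fixes X :: "'a::field mat"
  assumes X: "X \<in> carrier_mat n n" and ji: "1 \<le> j" "j < i" "i \<le> n"
    and H: "\<forall>S\<in>schroeder_paths n (node j) (node (i - 1)). weight_denom X S \<noteq> 0"
  shows "X $$ (i - 1, j - 1) = (\<Sum>S\<in>schroeder_paths n (node j) (node (i - 1)). weight X S)"
proof -
  have "(\<Sum>S\<in>schroeder_paths n (node j) (node (i - 1)). weight X S) =
      (- 1) ^ ((i - (i - 1) - 1) div 2) *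
      bordered_det (\<lambda>k l. X $$ (k, l)) (i - 1) i (\<lambda>k. X $$ (k, j - 1))"
  proof (subst node_eq_lattice_point[of "i - 1"], subst sum_weight_lattice_point[OF X ji(1,3)])
    show "P_label X (lattice_point (Suc s) q) \<noteq> 0" if "j \<le> q" "q < s" "s < i" for q s
      using that ji H by (intro labels_nonzero(1)[of j q s i n]) auto
    show "A_label X (lattice_point s (Suc q)) \<noteq> 0" if "j \<le> q" "Suc q < s" "s < i" for q s
      using that ji H by (intro labels_nonzero(2)[of j q s i n]) auto
  qed (use ji in auto)
  also have "\<dots> = X $$ (i - 1, j - 1)"
    using ji by (simp add: bordered_det_def det_single)
  finally show ?thesis by simp
qed

lemma prod_nonzero:
  fixes f :: "'b \<Rightarrow> 'a::semidom"
  shows "(\<And>k. k \<in> K \<Longrightarrow> f k \<noteq> 0) \<Longrightarrow> prod f K \<noteq> 0"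
  by (induction K rule: infinite_finite_induct) auto

text \<open>Every factor is the label of a vertex of the graph, hence up to sign a minor in distinct
  indeterminates.\<close>

lemma generic_weight_denom_nonzero:
  assumes S: "S \<in> schroeder_paths n u v"
  shows "weight_denom (generic_mat n :: 'a::field xratfun mat) S \<noteq> 0"
proof -
  let ?X = "generic_mat n :: 'a xratfun mat"
  have V: "S ! k \<in> vertices n" if "k < length S" for k
    using S that by (auto simp: schroeder_paths_def)
  have "P_label ?X w \<noteq> 0" "A_label ?X w \<noteq> 0" if "w \<in> vertices n" for w
    using that by (auto elim!: vertices_cases simp: generic_P_label_nonzero generic_A_label_nonzero)
  then have strict: "P_label ?X (S ! k) \<noteq> 0" "A_label ?X (S ! k) \<noteq> 0" if "k < length S" for k
    using that V by auto
  have mid: "P_label ?X (h + (0, 1)) \<noteq> 0" "1 \<le> snd h \<Longrightarrow> A_label ?X (h - (0, 1)) \<noteq> 0"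
    if hmid: "h \<in> horizontal_midpoints S" for h
  proof -
    obtain k where k: "k + 1 < length S" "S ! (k + 1) - S ! k = (2, 0)" and h: "h = S ! k + (1, 0)"
      using hmid unfolding horizontal_midpoints_def by blast
    obtain i j where w: "S ! k = lattice_point i j" and ij: "1 \<le> j" "j < i"
      using V[of k] k(1) by (auto elim: vertices_cases)
    \<comment> \<open>The end of the horizontal step lies in the graph, so the vertex above the
      midpoint also has first index \<open>Suc i\<close> at most \<open>n\<close>.\<close>
    have "S ! (k + 1) = lattice_point (Suc i) (Suc j)"
      using k(2) unfolding w by (auto simp: lattice_point_def prod_eq_iff)
    then have i: "Suc i \<le> n" using V[of "k + 1"] k(1) by (simp add: lattice_point_in_vertices_iff)
    have "h + (0, 1) = lattice_point (Suc i) j" by (simp add: h w lattice_point_def)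
    then show "P_label ?X (h + (0, 1)) \<noteq> 0"
      using ij i by (simp add: generic_P_label_nonzero)
    have "h - (0, 1) = lattice_point i (Suc j)" by (simp add: h w lattice_point_def)
    then show "A_label ?X (h - (0, 1)) \<noteq> 0" if "1 \<le> snd h"
      using ij i that by (simp add: generic_A_label_nonzero h w)
  qed
  show ?thesis
    unfolding weight_denom_def
    by (intro no_zero_divisors prod_nonzero mid strict)
      (simp_all add: strict_local_max_def strict_local_min_def)
qed

text \<open>Both identities are instances of \<open>matrix_entry_eq_sum_weight\<close>, over the
  rational functions and over \<open>'a\<close>.\<close>

theorem theorem3p1:
  fixes n i j :: nat
  assumes "2 \<le> n" and "1 \<le> j" and "j < i" and "i \<le> n"
  shows "((\<forall>S\<in>schroeder_paths n (node j) (node (i - 1)).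
             weight_denom (generic_mat n :: 'a::field xratfun mat) S \<noteq> 0) \<and>
          (generic_mat n :: 'a xratfun mat) $$ (i - 1, j - 1) =
             (\<Sum>S\<in>schroeder_paths n (node j) (node (i - 1)). weight (generic_mat n) S)) \<and>
         (\<forall>X::'a mat. X \<in> carrier_mat n n \<longrightarrow>
            (\<forall>S\<in>schroeder_paths n (node j) (node (i - 1)). weight_denom X S \<noteq> 0) \<longrightarrow>
            X $$ (i - 1, j - 1) = (\<Sum>S\<in>schroeder_paths n (node j) (node (i - 1)). weight X S))"
proof (intro conjI allI impI)
  let ?X = "generic_mat n :: 'a xratfun mat" and ?P = "schroeder_paths n (node j) (node (i - 1))"
  show denom: "\<forall>S\<in>?P. weight_denom ?X S \<noteq> 0"
    using generic_weight_denom_nonzero by blast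
  show "?X $$ (i - 1, j - 1) = (\<Sum>S\<in>?P. weight ?X S)"
    using assms(2-4) denom by (intro matrix_entry_eq_sum_weight) (simp_all add: generic_mat_def)
  show "X $$ (i - 1, j - 1) = (\<Sum>S\<in>?P. weight X S)"
    if "X \<in> carrier_mat n n" "\<forall>S\<in>?P. weight_denom X S \<noteq> 0" for X :: "'a mat"
    using assms(2-4) that by (intro matrix_entry_eq_sum_weight)
qed

end
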